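(* Let $(\mathcal C,U)$ be a UD-category. The following conditions are equivalent for an object $C$ of $\mathcal C$ and a class $\mathcal D$ of objects of $\mathcal C$: (1) $C$ is $\mathcal D$-connected; (2) for each pair of objects $A_1\in\mathcal D$ and $A_2\in\mathcal D^{\coprod}$ and each morphism $f\in\mathrm{Mor}(C,A_1\sqcup A_2)$ there exists $i\in\{1,2\}$ such that $f$ factorizes through $\nu_i$; (3) for each pair of objects $A_1\in\mathcal D$ and $A_2\in\mathcal D^{\coprod}$ and each morphism $f\in\mathrm{Mor}(C,A_1\sqcup A_2)$ there exists $i\in\{1,2\}$ such that $U(f)(U(C))\subseteq U(\nu_i)(U(A_i))$; (4) for each family $(A_i,i\in I)$ of objects of $\mathcal D$ and each morphism $f\in\mathrm{Mor}(C,\coprod_{i\in I}A_i)$ there exists $i\in I$ such that $f$ factorizes through $\nu_i$; (5) for each family $(A_i,i\in I)$ of objects of $\mathcal D$ and each morphism $f\in\mathrm{Mor}(C,\coprod_{i\in I}A_i)$ there exists $i\in I$ such that $U(f)(U(C))\subseteq U(\nu_i)(U(A_i))$; where $\nu_i$ denotes the structural morphism of the corresponding coproduct $A_1\sqcup A_2$ or $\coprod_{i\in I}A_i$.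
   Context: $\mathrm{Mor}(A,B)$ denotes the class of morphisms $A\to B$. A family of objects means any discrete diagram. A concrete category over the category $\mathrm{Set}$ of sets is a pair $(\mathcal C,U)$, where $\mathcal C$ is a category and $U:\mathcal C\to\mathrm{Set}$ is a faithful functor. A category is coproduct complete if its class of objects is closed under all coproducts; it is balanced if every morphism that is both a monomorphism and an epimorphism is an isomorphism. A subobject of an object $A$ is a pair $(S,\nu)$ where $S$ is an object and $\nu:S\to A$ is a monomorphism. In a coproduct complete category with an initial object $\theta\cong\coprod\emptyset$, an object is indecomposable if it is not isomorphic to an initial object nor to a coproduct of two non-initial objects. A concrete category $(\mathcal C,U)$ over $\mathrm{Set}$ is a UD-category if the following hold: (UD1) $\mathcal C$ is a coproduct complete balanced category with an initial object $\theta\cong\coprod\emptyset$, for which each morphism $\theta\to A$ is a monomorphism and there is at most one morphism $A\to\theta$; (UD2) for any morphism $f\in\mathrm{Mor}(A,B)$ there exists a subobject $(A^f,\iota)$ of $B$ such that $U(A^f)=U(f)(U(A))\subseteq U(B)$ and $U(\iota)$ is the subset inclusion map; (UD3) for each morphism $f\in\mathrm{Mor}(A,B)$ and every subobject $(S,\nu)$ of $B$ such that $U(f)(U(A))\subseteq U(\nu)(U(S))$, there exists a morphism $g\in\mathrm{Mor}(A,S)$ such that $f=\nu g$; (UD4) for every family $(A_i,\nu_i)_{i\in I}$ of subobjects of an object $A$ there exist subobjects $(\bigcap_iA_i^{\nu_i},\iota_\cap)$ and $(\bigcup_iA_i^{\nu_i},\iota_\cup)$ of $A$ such that $U(\bigcap_iA_i^{\nu_i})=\bigcap_iU(\nu_i)(U(A_i))=\bigcap_iU(A_i^{\nu_i})$,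 $U(\bigcup_iA_i^{\nu_i})=\bigcup_iU(\nu_i)(U(A_i))=\bigcup_iU(A_i^{\nu_i})$, and both $U(\iota_\cap)$, $U(\iota_\cup)$ are the corresponding subset inclusion maps; (UD5) if $(A,(\nu_0,\nu_1))$ is a coproduct of a pair of objects $(A_0,A_1)$, then $\nu_0$ and $\nu_1$ are monomorphisms and $A_0^{\nu_0}\cap A_1^{\nu_1}$ is isomorphic to $\theta$; (UD6) for every object $A$ and every $x\in U(A)$ there exists an indecomposable subobject $(B,\nu)$ of $A$ such that $x\in U(B^\nu)=U(\nu)(U(B))\subseteq U(A)$. For an object $C$ and a family $\mathcal A=(A_i,i\in I)$ of objects with coproduct $(\coprod_{i\in I}A_i,(\nu_i)_{i\in I})$, let $\Psi^C_{\mathcal A}:\coprod_{i\in I}\mathrm{Mor}(C,A_i)\to\mathrm{Mor}(C,\coprod_{i\in I}A_i)$ be the map from the coproduct in $\mathrm{Set}$ (the disjoint union) given by $\Psi^C_{\mathcal A}(\alpha)=\nu_i\alpha$ for $\alpha\in\mathrm{Mor}(C,A_i)$. The object $C$ is $\mathcal D$-connected if $\Psi^C_{\mathcal A}$ is surjective for each family $\mathcal A$ of objects from the class $\mathcal D$. $\mathcal D^{\coprod}=\{\coprod_iD_i\mid D_i\in\mathcal D\}$ denotes the class of all coproducts of all families of objects of $\mathcal D$.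
   Formalization: The families in (4), (5) and in the definition of D-connected in (1) are taken to be nonempty; with the empty family allowed the equivalence fails for initial C, since (2) and (3) hold while Mor(C, θ) is nonempty and there is no index i. *)

theory Defs
  imports Main "HOL-Library.FuncSet"
begin

section \<open>Categories and functors\<close>

record ('o, 'm) cat =
  Obj :: "'o set"
  Arr :: "'m set"
  Dom :: "'m \<Rightarrow> 'o"
  Cod :: "'m \<Rightarrow> 'o"
  Id :: "'o \<Rightarrow> 'm"
  Comp :: "'m \<Rightarrow> 'm \<Rightarrow> 'm" (infixl "\<cdot>\<index>" 70)

definition Mor :: "('o, 'm) cat \<Rightarrow> 'o \<Rightarrow> 'o \<Rightarrow> 'm set" where
  "Mor \<C> A B = {f \<in> Arr \<C>. Dom \<C> f = A \<and> Cod \<C> f = B}"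

definition category :: "('o, 'm) cat \<Rightarrow> bool" where
  "category \<C> \<longleftrightarrow>
     (\<forall>f\<in>Arr \<C>. Dom \<C> f \<in> Obj \<C> \<and> Cod \<C> f \<in> Obj \<C>) \<and>
     (\<forall>A\<in>Obj \<C>. Id \<C> A \<in> Mor \<C> A A) \<and>
     (\<forall>A B C f g. f \<in> Mor \<C> A B \<longrightarrow> g \<in> Mor \<C> B C \<longrightarrow> g \<cdot>\<^bsub>\<C>\<^esub> f \<in> Mor \<C> A C) \<and>
     (\<forall>A B f. f \<in> Mor \<C> A B \<longrightarrow> f \<cdot>\<^bsub>\<C>\<^esub> Id \<C> A = f \<and> Id \<C> B \<cdot>\<^bsub>\<C>\<^esub> f = f) \<and>
     (\<forall>A B C D f g h. f \<in> Mor \<C> A B \<longrightarrow> g \<in> Mor \<C> B C \<longrightarrow> h \<in> Mor \<C> C D \<longrightarrow>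
        h \<cdot>\<^bsub>\<C>\<^esub> (g \<cdot>\<^bsub>\<C>\<^esub> f) = (h \<cdot>\<^bsub>\<C>\<^esub> g) \<cdot>\<^bsub>\<C>\<^esub> f)"

record ('o, 'm, 'p, 'n) functr =
  on_obj :: "'o \<Rightarrow> 'p"
  on_arr :: "'m \<Rightarrow> 'n"

definition is_functor ::
  "('o, 'm) cat \<Rightarrow> ('p, 'n) cat \<Rightarrow> ('o, 'm, 'p, 'n) functr \<Rightarrow> bool" where
  "is_functor \<C> \<B> F \<longleftrightarrow>
     (\<forall>A\<in>Obj \<C>. on_obj F A \<in> Obj \<B>) \<and>
     (\<forall>A B f. f \<in> Mor \<C> A B \<longrightarrow> on_arr F f \<in> Mor \<B> (on_obj F A) (on_obj F B)) \<and>
     (\<forall>A\<in>Obj \<C>. on_arr F (Id \<C> A) = Id \<B> (on_obj F A)) \<and>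
     (\<forall>A B C f g. f \<in> Mor \<C> A B \<longrightarrow> g \<in> Mor \<C> B C \<longrightarrow>
        on_arr F (g \<cdot>\<^bsub>\<C>\<^esub> f) = on_arr F g \<cdot>\<^bsub>\<B>\<^esub> on_arr F f)"

definition faithful :: "('o, 'm) cat \<Rightarrow> ('o, 'm, 'p, 'n) functr \<Rightarrow> bool" where
  "faithful \<C> F \<longleftrightarrow>
     (\<forall>A B f g. f \<in> Mor \<C> A B \<longrightarrow> g \<in> Mor \<C> A B \<longrightarrow> on_arr F f = on_arr F g \<longrightarrow> f = g)"

text \<open>The category of sets, relative to a type \<open>'u\<close>: its objects are all sets of
  elements of \<open>'u\<close>. The underlying function of a map is undefined outside the source, so
  that equality of maps is equality of graphs together with source and target.\<close>

datatype 'u set_map = Set_Map (src: "'u set") (fn: "'u \<Rightarrow> 'u") (tgt: "'u set")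

definition SetCat :: "('u set, 'u set_map) cat" where
  "SetCat = \<lparr> Obj = UNIV,
              Arr = {m. fn m \<in> src m \<rightarrow>\<^sub>E tgt m},
              Dom = src,
              Cod = tgt,
              Id = (\<lambda>X. Set_Map X (\<lambda>x\<in>X. x) X),
              Comp = (\<lambda>n m. Set_Map (src m) (compose (src m) (fn n) (fn m)) (tgt n)) \<rparr>"

definition incl :: "'u set \<Rightarrow> 'u set \<Rightarrow> 'u set_map" where
  "incl X Y = Set_Map X (\<lambda>x\<in>X. x) Y"

type_synonym ('o, 'm, 'u) set_functr = "('o, 'm, 'u set, 'u set_map) functr"

definition concrete_category :: "('o, 'm) cat \<Rightarrow> ('o, 'm, 'u) set_functr \<Rightarrow> bool" where
  "concrete_category \<C> U \<longleftrightarrow> category \<C> \<and> is_functor \<C> SetCat U \<and> faithful \<C> U"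


section \<open>Morphisms, subobjects, coproducts\<close>

definition mono_arr :: "('o, 'm) cat \<Rightarrow> 'm \<Rightarrow> bool" where
  "mono_arr \<C> f \<longleftrightarrow> f \<in> Arr \<C> \<and>
     (\<forall>A. \<forall>g\<in>Mor \<C> A (Dom \<C> f). \<forall>h\<in>Mor \<C> A (Dom \<C> f).
        f \<cdot>\<^bsub>\<C>\<^esub> g = f \<cdot>\<^bsub>\<C>\<^esub> h \<longrightarrow> g = h)"

definition epi_arr :: "('o, 'm) cat \<Rightarrow> 'm \<Rightarrow> bool" where
  "epi_arr \<C> f \<longleftrightarrow> f \<in> Arr \<C> \<and>
     (\<forall>B. \<forall>g\<in>Mor \<C> (Cod \<C> f) B. \<forall>h\<in>Mor \<C> (Cod \<C> f) B.
        g \<cdot>\<^bsub>\<C>\<^esub> f = h \<cdot>\<^bsub>\<C>\<^esub> f \<longrightarrow> g = h)"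

definition iso_arr :: "('o, 'm) cat \<Rightarrow> 'm \<Rightarrow> bool" where
  "iso_arr \<C> f \<longleftrightarrow> f \<in> Arr \<C> \<and>
     (\<exists>g\<in>Mor \<C> (Cod \<C> f) (Dom \<C> f).
        g \<cdot>\<^bsub>\<C>\<^esub> f = Id \<C> (Dom \<C> f) \<and> f \<cdot>\<^bsub>\<C>\<^esub> g = Id \<C> (Cod \<C> f))"

definition isomorphic :: "('o, 'm) cat \<Rightarrow> 'o \<Rightarrow> 'o \<Rightarrow> bool" where
  "isomorphic \<C> A B \<longleftrightarrow> (\<exists>f\<in>Mor \<C> A B. iso_arr \<C> f)"

definition balanced :: "('o, 'm) cat \<Rightarrow> bool" where
  "balanced \<C> \<longleftrightarrow> (\<forall>f. mono_arr \<C> f \<and> epi_arr \<C> f \<longrightarrow> iso_arr \<C> f)"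

definition initial :: "('o, 'm) cat \<Rightarrow> 'o \<Rightarrow> bool" where
  "initial \<C> T \<longleftrightarrow> T \<in> Obj \<C> \<and> (\<forall>A\<in>Obj \<C>. \<exists>!f. f \<in> Mor \<C> T A)"

definition subobject :: "('o, 'm) cat \<Rightarrow> 'o \<Rightarrow> 'o \<Rightarrow> 'm \<Rightarrow> bool" where
  "subobject \<C> A S \<nu> \<longleftrightarrow> S \<in> Obj \<C> \<and> \<nu> \<in> Mor \<C> S A \<and> mono_arr \<C> \<nu>"

text \<open>\<open>(P, (\<nu> i)\<^sub>i)\<close> is a coproduct of the family \<open>(A i)\<^sub>i\<close>, \<open>i \<in> I\<close>. Nothing is
  said about \<open>A\<close> and \<open>\<nu>\<close> outside \<open>I\<close>.\<close>

definition is_coproduct ::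
  "('o, 'm) cat \<Rightarrow> 'j set \<Rightarrow> ('j \<Rightarrow> 'o) \<Rightarrow> 'o \<Rightarrow> ('j \<Rightarrow> 'm) \<Rightarrow> bool" where
  "is_coproduct \<C> I A P \<nu> \<longleftrightarrow>
     P \<in> Obj \<C> \<and> (\<forall>i\<in>I. A i \<in> Obj \<C> \<and> \<nu> i \<in> Mor \<C> (A i) P) \<and>
     (\<forall>X\<in>Obj \<C>. \<forall>\<phi>. (\<forall>i\<in>I. \<phi> i \<in> Mor \<C> (A i) X) \<longrightarrow>
        (\<exists>!h. h \<in> Mor \<C> P X \<and> (\<forall>i\<in>I. h \<cdot>\<^bsub>\<C>\<^esub> \<nu> i = \<phi> i)))"

text \<open>HOL cannot quantify over the index types of all families, so an index type \<open>'i\<close> is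
  passed as a parameter; families are indexed by arbitrary subsets of \<open>'i\<close>, including the
  empty one unless it is excluded explicitly.\<close>

definition coproduct_complete :: "'i itself \<Rightarrow> ('o, 'm) cat \<Rightarrow> bool" where
  "coproduct_complete (_ :: 'i itself) \<C> \<longleftrightarrow>
     (\<forall>(I :: 'i set) A. (\<forall>i\<in>I. A i \<in> Obj \<C>) \<longrightarrow> (\<exists>P \<nu>. is_coproduct \<C> I A P \<nu>))"

definition indecomposable :: "('o, 'm) cat \<Rightarrow> 'o \<Rightarrow> bool" where
  "indecomposable \<C> B \<longleftrightarrow> B \<in> Obj \<C> \<and>
     \<not> (\<exists>T. initial \<C> T \<and> isomorphic \<C> B T) \<and>
     \<not> (\<exists>A P \<nu>. is_coproduct \<C> {0, 1 :: nat} A P \<nu> \<and>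
          \<not> initial \<C> (A 0) \<and> \<not> initial \<C> (A 1) \<and> isomorphic \<C> B P)"

definition factors_through :: "('o, 'm) cat \<Rightarrow> 'm \<Rightarrow> 'm \<Rightarrow> bool" where
  "factors_through \<C> f \<nu> \<longleftrightarrow>
     (\<exists>g\<in>Mor \<C> (Dom \<C> f) (Dom \<C> \<nu>). f = \<nu> \<cdot>\<^bsub>\<C>\<^esub> g)"


section \<open>UD-categories\<close>

text \<open>The image \<open>U(f)(U(A))\<close> of \<open>f : A \<rightarrow> B\<close>.\<close>

definition U_image :: "('o, 'm) cat \<Rightarrow> ('o, 'm, 'u) set_functr \<Rightarrow> 'm \<Rightarrow> 'u set" where
  "U_image \<C> U f = fn (on_arr U f) ` on_obj U (Dom \<C> f)"

definition set_subobject ::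
  "('o, 'm) cat \<Rightarrow> ('o, 'm, 'u) set_functr \<Rightarrow> 'o \<Rightarrow> 'u set \<Rightarrow> 'o \<Rightarrow> 'm \<Rightarrow> bool" where
  "set_subobject \<C> U A X S \<iota> \<longleftrightarrow>
     subobject \<C> A S \<iota> \<and> on_obj U S = X \<and> on_arr U \<iota> = incl X (on_obj U A)"

text \<open>The empty coproduct is initial, so \<open>\<theta> \<cong> \<Coprod>\<emptyset>\<close> needs no separate clause.\<close>

definition UD1 :: "'i itself \<Rightarrow> ('o, 'm) cat \<Rightarrow> bool" where
  "UD1 (ty :: 'i itself) \<C> \<longleftrightarrow>
     coproduct_complete ty \<C> \<and> balanced \<C> \<and>
     (\<exists>\<theta>. initial \<C> \<theta> \<and>
        (\<forall>A\<in>Obj \<C>. \<forall>f\<in>Mor \<C> \<theta> A. mono_arr \<C> f) \<and>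
        (\<forall>A\<in>Obj \<C>. \<forall>f\<in>Mor \<C> A \<theta>. \<forall>g\<in>Mor \<C> A \<theta>. f = g))"

definition UD2 :: "('o, 'm) cat \<Rightarrow> ('o, 'm, 'u) set_functr \<Rightarrow> bool" where
  "UD2 \<C> U \<longleftrightarrow>
     (\<forall>A B. \<forall>f\<in>Mor \<C> A B. \<exists>S \<iota>. set_subobject \<C> U B (U_image \<C> U f) S \<iota>)"

definition UD3 :: "('o, 'm) cat \<Rightarrow> ('o, 'm, 'u) set_functr \<Rightarrow> bool" where
  "UD3 \<C> U \<longleftrightarrow>
     (\<forall>A B S \<nu>. \<forall>f\<in>Mor \<C> A B. subobject \<C> B S \<nu> \<longrightarrow> U_image \<C> U f \<subseteq> U_image \<C> U \<nu> \<longrightarrow>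
        (\<exists>g\<in>Mor \<C> A S. f = \<nu> \<cdot>\<^bsub>\<C>\<^esub> g))"

text \<open>The empty family is left out, so as not to depend on a convention for empty
  intersections; nothing is lost, since the other axioms provide both subobjects for it:
  the intersection \<open>A\<close> (by \<open>UD2\<close> for the identity) and the union \<open>\<emptyset> = U(\<theta>)\<close>
  (\<open>UD6\<close> forces \<open>U(\<theta>) = \<emptyset>\<close>). The sets \<open>U(A\<^sub>i\<^sup>\<nu>)\<close>, with \<open>A\<^sub>i\<^sup>\<nu>\<close> the image subobject
  from \<open>UD2\<close>, are by definition the images used below.\<close>

definition UD4 :: "'i itself \<Rightarrow> ('o, 'm) cat \<Rightarrow> ('o, 'm, 'u) set_functr \<Rightarrow> bool" where
  "UD4 (_ :: 'i itself) \<C> U \<longleftrightarrow>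
     (\<forall>A\<in>Obj \<C>. \<forall>(I :: 'i set) B \<nu>. I \<noteq> {} \<longrightarrow> (\<forall>i\<in>I. subobject \<C> A (B i) (\<nu> i)) \<longrightarrow>
        (\<exists>S \<iota>. set_subobject \<C> U A (\<Inter>i\<in>I. U_image \<C> U (\<nu> i)) S \<iota>) \<and>
        (\<exists>S \<iota>. set_subobject \<C> U A (\<Union>i\<in>I. U_image \<C> U (\<nu> i)) S \<iota>))"

text \<open>The intersection is determined up to isomorphism by \<open>UD3\<close>; the clause ranges over
  all of its representatives.\<close>

definition UD5 :: "('o, 'm) cat \<Rightarrow> ('o, 'm, 'u) set_functr \<Rightarrow> bool" where
  "UD5 \<C> U \<longleftrightarrow>
     (\<forall>A B \<nu>. is_coproduct \<C> {0, 1 :: nat} B A \<nu> \<longrightarrow>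
        mono_arr \<C> (\<nu> 0) \<and> mono_arr \<C> (\<nu> 1) \<and>
        (\<forall>S \<iota>. set_subobject \<C> U A (U_image \<C> U (\<nu> 0) \<inter> U_image \<C> U (\<nu> 1)) S \<iota> \<longrightarrow>
           (\<exists>\<theta>. initial \<C> \<theta> \<and> isomorphic \<C> S \<theta>)))"

definition UD6 :: "('o, 'm) cat \<Rightarrow> ('o, 'm, 'u) set_functr \<Rightarrow> bool" where
  "UD6 \<C> U \<longleftrightarrow>
     (\<forall>A\<in>Obj \<C>. \<forall>x\<in>on_obj U A.
        \<exists>B \<nu>. subobject \<C> A B \<nu> \<and> indecomposable \<C> B \<and> x \<in> U_image \<C> U \<nu>)"

definition UD_category ::
  "'i itself \<Rightarrow> ('o, 'm) cat \<Rightarrow> ('o, 'm, 'u) set_functr \<Rightarrow> bool" where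
  "UD_category (ty :: 'i itself) \<C> U \<longleftrightarrow>
     concrete_category \<C> U \<and> UD1 ty \<C> \<and> UD2 \<C> U \<and> UD3 \<C> U \<and> UD4 ty \<C> U \<and> UD5 \<C> U \<and> UD6 \<C> U"


section \<open>Connected objects\<close>

definition Psi :: "('o, 'm) cat \<Rightarrow> ('j \<Rightarrow> 'm) \<Rightarrow> 'j \<times> 'm \<Rightarrow> 'm" where
  "Psi \<C> \<nu> = (\<lambda>(i, \<alpha>). \<nu> i \<cdot>\<^bsub>\<C>\<^esub> \<alpha>)"

text \<open>The empty family is excluded. Its map \<open>\<Psi>\<close> goes from the empty set to
  \<open>Mor(C, \<theta>)\<close>, which in a UD-category is nonempty exactly if \<open>C\<close> is initial. Admitting
  it would thus only make initial objects disconnected, although morphisms from them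
  into a coproduct of two objects always factor through both summands.\<close>

definition connected_object ::
  "'i itself \<Rightarrow> ('o, 'm) cat \<Rightarrow> 'o set \<Rightarrow> 'o \<Rightarrow> bool" where
  "connected_object (_ :: 'i itself) \<C> \<D> C \<longleftrightarrow>
     (\<forall>(I :: 'i set) A P \<nu>. I \<noteq> {} \<longrightarrow> (\<forall>i\<in>I. A i \<in> \<D>) \<longrightarrow> is_coproduct \<C> I A P \<nu> \<longrightarrow>
        Psi \<C> \<nu> ` (SIGMA i:I. Mor \<C> C (A i)) = Mor \<C> C P)"

definition coproducts_of :: "'i itself \<Rightarrow> ('o, 'm) cat \<Rightarrow> 'o set \<Rightarrow> 'o set" where
  "coproducts_of (_ :: 'i itself) \<C> \<D> =
     {P. \<exists>(I :: 'i set) A \<nu>. (\<forall>i\<in>I. A i \<in> \<D>) \<and> is_coproduct \<C> I A P \<nu>}"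

end

theory Submission
  imports Defs
begin

text \<open>
  Why the five conditions agree. Everything rests on two facts about a coproduct
  \<open>P = \<Coprod>\<^sub>i A\<^sub>i\<close> with injections \<open>\<nu>\<^sub>i\<close> in a UD-category.

  First, \<open>\<nu>\<^sub>i\<close> is a monomorphism: \<open>P\<close> is also the binary coproduct of \<open>A\<^sub>i\<close> and the
  coproduct \<open>Q\<^sub>i\<close> of the other summands (\<open>coproduct_split\<close>), and \<open>UD5\<close> applies to binary
  coproducts. By \<open>UD3\<close>, a morphism then factorizes through \<open>\<nu>\<^sub>i\<close> exactly if its image lies in
  the image of \<open>\<nu>\<^sub>i\<close> (\<open>factors_iff_image\<close>). This makes conditions (2) and (3) equivalent, and
  likewise (4) and (5). Conditions (1) and (4) are the same up to unfolding.

  Second, on underlying sets \<open>P\<close> behaves like a disjoint union: the images of the \<open>\<nu>\<^sub>i\<close> cover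
  \<open>U P\<close> (\<open>coproduct_images_cover\<close>), and the image of \<open>A\<^sub>i\<close> is disjoint from that of \<open>Q\<^sub>i\<close>
  (\<open>binary_images_disjoint\<close>).

  From (3) to (5) (\<open>family_image\<close>), let \<open>f : C \<rightarrow> P\<close> and pick a point \<open>y\<close> of its image; \<open>y\<close> lies
  in the image of some \<open>A\<^sub>i\<close>. Condition (3) for \<open>P = A\<^sub>i \<squnion> Q\<^sub>i\<close> puts the whole image of \<open>f\<close> into
  one of the two disjoint parts, and \<open>y\<close> decides that it is the one of \<open>A\<^sub>i\<close>. If \<open>f\<close> has empty
  image, any index will do, which is where the family has to be nonempty.

  From (4) to (2) (\<open>binary_factorization\<close>), a coproduct \<open>A\<^sub>1 \<squnion> \<Coprod>\<^sub>j B\<^sub>j\<close> is the coproduct of the family \<open>B\<close> enlarged by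
  \<open>A\<^sub>1\<close> (\<open>coproduct_extend\<close>), and a factorization through some \<open>B\<^sub>j\<close> is one through the second
  summand. An infinite index type has room for the additional index.
\<close>

section \<open>Coproducts in a category\<close>

locale categ =
  fixes \<C> :: "('o, 'm) cat" (structure)
  assumes category: "category \<C>"
begin

lemma Mor_ObjD: "f \<in> Mor \<C> A B \<Longrightarrow> A \<in> Obj \<C> \<and> B \<in> Obj \<C>"
  using category unfolding category_def Mor_def by auto

lemma Mor_DomCod: "f \<in> Mor \<C> A B \<Longrightarrow> f \<in> Arr \<C> \<and> Dom \<C> f = A \<and> Cod \<C> f = B"
  unfolding Mor_def by auto

lemma Id_Mor: "A \<in> Obj \<C> \<Longrightarrow> Id \<C> A \<in> Mor \<C> A A"
  using category unfolding category_def by auto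

lemma comp_Mor: "f \<in> Mor \<C> A B \<Longrightarrow> g \<in> Mor \<C> B D \<Longrightarrow> g \<cdot> f \<in> Mor \<C> A D"
  using category unfolding category_def by blast

lemma comp_Id: "f \<in> Mor \<C> A B \<Longrightarrow> f \<cdot> Id \<C> A = f"
  and Id_comp: "f \<in> Mor \<C> A B \<Longrightarrow> Id \<C> B \<cdot> f = f"
  using category unfolding category_def by blast+

lemma comp_assoc:
  "f \<in> Mor \<C> A B \<Longrightarrow> g \<in> Mor \<C> B D \<Longrightarrow> h \<in> Mor \<C> D E \<Longrightarrow> (h \<cdot> g) \<cdot> f = h \<cdot> (g \<cdot> f)"
  using category unfolding category_def by metis

lemma mono_arrD:
  "mono_arr \<C> f \<Longrightarrow> f \<in> Mor \<C> A B \<Longrightarrow> g \<in> Mor \<C> X A \<Longrightarrow> h \<in> Mor \<C> X A \<Longrightarrow> f \<cdot> g = f \<cdot> h \<Longrightarrow> g = h"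
  unfolding mono_arr_def using Mor_DomCod by blast

lemma coproduct_obj: "is_coproduct \<C> I A P \<nu> \<Longrightarrow> P \<in> Obj \<C>"
  and coproduct_inj: "is_coproduct \<C> I A P \<nu> \<Longrightarrow> i \<in> I \<Longrightarrow> \<nu> i \<in> Mor \<C> (A i) P"
  unfolding is_coproduct_def by auto

lemma coproduct_mediator:
  assumes "is_coproduct \<C> I A P \<nu>" "X \<in> Obj \<C>" "\<And>i. i \<in> I \<Longrightarrow> \<phi> i \<in> Mor \<C> (A i) X"
  obtains h where "h \<in> Mor \<C> P X" "\<And>i. i \<in> I \<Longrightarrow> h \<cdot> \<nu> i = \<phi> i"
proof -
  have "\<exists>!h. h \<in> Mor \<C> P X \<and> (\<forall>i\<in>I. h \<cdot> \<nu> i = \<phi> i)"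
    using assms unfolding is_coproduct_def by simp
  then show thesis using that by blast
qed

lemma coproduct_eqI:
  assumes "is_coproduct \<C> I A P \<nu>" "h \<in> Mor \<C> P X" "h' \<in> Mor \<C> P X"
    and "\<And>i. i \<in> I \<Longrightarrow> h \<cdot> \<nu> i = h' \<cdot> \<nu> i"
  shows "h = h'"
proof -
  have X: "X \<in> Obj \<C>" using assms(2) Mor_ObjD by blast
  have "\<forall>i\<in>I. h \<cdot> \<nu> i \<in> Mor \<C> (A i) X"
    using comp_Mor[OF coproduct_inj[OF assms(1)] assms(2)] by blast
  then have "\<exists>!k. k \<in> Mor \<C> P X \<and> (\<forall>i\<in>I. k \<cdot> \<nu> i = h \<cdot> \<nu> i)"
    using assms(1) X unfolding is_coproduct_def by simp
  then show ?thesis using assms(2-4) by (metis (no_types, lifting))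
qed

lemma is_coproductI:
  assumes "P \<in> Obj \<C>" and inj: "\<And>i. i \<in> I \<Longrightarrow> \<nu> i \<in> Mor \<C> (A i) P"
    and ex: "\<And>X \<phi>. X \<in> Obj \<C> \<Longrightarrow> (\<And>i. i \<in> I \<Longrightarrow> \<phi> i \<in> Mor \<C> (A i) X) \<Longrightarrow>
          \<exists>h\<in>Mor \<C> P X. \<forall>i\<in>I. h \<cdot> \<nu> i = \<phi> i"
    and uniq: "\<And>X h h'. h \<in> Mor \<C> P X \<Longrightarrow> h' \<in> Mor \<C> P X \<Longrightarrow>
          (\<And>i. i \<in> I \<Longrightarrow> h \<cdot> \<nu> i = h' \<cdot> \<nu> i) \<Longrightarrow> h = h'"
  shows "is_coproduct \<C> I A P \<nu>"
  unfolding is_coproduct_def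
proof (intro conjI ballI allI impI)
  fix X \<phi> assume "X \<in> Obj \<C>" "\<forall>i\<in>I. \<phi> i \<in> Mor \<C> (A i) X"
  then obtain h where h: "h \<in> Mor \<C> P X" "\<forall>i\<in>I. h \<cdot> \<nu> i = \<phi> i" using ex[of X \<phi>] by blast
  show "\<exists>!h. h \<in> Mor \<C> P X \<and> (\<forall>i\<in>I. h \<cdot> \<nu> i = \<phi> i)"
  proof (rule ex1I[of _ h])
    fix h' assume "h' \<in> Mor \<C> P X \<and> (\<forall>i\<in>I. h' \<cdot> \<nu> i = \<phi> i)"
    with h show "h' = h" by (intro uniq[of h' X h]) auto
  qed (use h in blast)
qed (use assms(1) inj Mor_ObjD in blast)+

lemma coproduct_reindex:
  assumes c: "is_coproduct \<C> I A P \<nu>" and s: "bij_betw \<sigma> J I"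
  shows "is_coproduct \<C> J (A \<circ> \<sigma>) P (\<nu> \<circ> \<sigma>)"
proof (rule is_coproductI)
  show "P \<in> Obj \<C>" using c by (rule coproduct_obj)
  show "(\<nu> \<circ> \<sigma>) j \<in> Mor \<C> ((A \<circ> \<sigma>) j) P" if "j \<in> J" for j
    using coproduct_inj[OF c] that s bij_betwE by fastforce
next
  fix X \<phi>
  assume X: "X \<in> Obj \<C>" and \<phi>: "\<And>j. j \<in> J \<Longrightarrow> \<phi> j \<in> Mor \<C> ((A \<circ> \<sigma>) j) X"
  have "\<phi> (inv_into J \<sigma> i) \<in> Mor \<C> (A i) X" if "i \<in> I" for i
    using \<phi>[of "inv_into J \<sigma> i"] that s
    by (simp add: bij_betw_inv_into_right bij_betw_imp_surj_on inv_into_into)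
  then obtain h where h: "h \<in> Mor \<C> P X" "\<And>i. i \<in> I \<Longrightarrow> h \<cdot> \<nu> i = \<phi> (inv_into J \<sigma> i)"
    using coproduct_mediator[OF c X, of "\<lambda>i. \<phi> (inv_into J \<sigma> i)"] by blast
  have "h \<cdot> (\<nu> \<circ> \<sigma>) j = \<phi> j" if "j \<in> J" for j
    using h(2)[of "\<sigma> j"] that s bij_betwE bij_betw_inv_into_left by fastforce
  then show "\<exists>h\<in>Mor \<C> P X. \<forall>j\<in>J. h \<cdot> (\<nu> \<circ> \<sigma>) j = \<phi> j" using h(1) by blast
next
  fix X h h'
  assume h: "h \<in> Mor \<C> P X" "h' \<in> Mor \<C> P X"
    and eq: "\<And>j. j \<in> J \<Longrightarrow> h \<cdot> (\<nu> \<circ> \<sigma>) j = h' \<cdot> (\<nu> \<circ> \<sigma>) j"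
  show "h = h'"
  proof (rule coproduct_eqI[OF c h])
    fix i assume "i \<in> I"
    then obtain j where "j \<in> J" "i = \<sigma> j" using s by (metis bij_betw_imp_surj_on imageE)
    then show "h \<cdot> \<nu> i = h' \<cdot> \<nu> i" using eq by fastforce
  qed
qed

text \<open>Associativity of coproducts, read as detaching one summand: the second injection is the
  morphism \<open>Q \<rightarrow> P\<close> that restricts to the remaining injections of \<open>P\<close>.\<close>

lemma coproduct_split:
  assumes c: "is_coproduct \<C> I A P \<nu>" and i: "i \<in> I"
    and q: "is_coproduct \<C> (I - {i}) A Q \<mu>"
  shows "\<exists>\<kappa>. is_coproduct \<C> {1, 2 :: nat} (\<lambda>k. if k = 1 then A i else Q) P
               (\<lambda>k. if k = 1 then \<nu> i else \<kappa>)"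
proof -
  have P: "P \<in> Obj \<C>" using c by (rule coproduct_obj)
  obtain \<kappa> where \<kappa>: "\<kappa> \<in> Mor \<C> Q P" and \<kappa>\<mu>: "\<And>j. j \<in> I - {i} \<Longrightarrow> \<kappa> \<cdot> \<mu> j = \<nu> j"
    using coproduct_mediator[OF q P, of \<nu>] coproduct_inj[OF c] by blast
  have assoc: "(h \<cdot> \<kappa>) \<cdot> \<mu> j = h \<cdot> \<nu> j" if "h \<in> Mor \<C> P X" "j \<in> I - {i}" for h X j
    using comp_assoc[OF coproduct_inj[OF q that(2)] \<kappa> that(1)] \<kappa>\<mu>[OF that(2)] by simp
  have "is_coproduct \<C> {1, 2 :: nat} (\<lambda>k. if k = 1 then A i else Q) P
          (\<lambda>k. if k = 1 then \<nu> i else \<kappa>)"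
  proof (rule is_coproductI)
    show "(if k = 1 then \<nu> i else \<kappa>) \<in> Mor \<C> (if k = 1 then A i else Q) P" for k :: nat
      using coproduct_inj[OF c i] \<kappa> by simp
  next
    fix X and \<phi> :: "nat \<Rightarrow> 'm"
    assume X: "X \<in> Obj \<C>"
      and \<phi>: "\<And>k. k \<in> {1, 2} \<Longrightarrow> \<phi> k \<in> Mor \<C> (if k = 1 then A i else Q) X"
    have \<phi>1: "\<phi> 1 \<in> Mor \<C> (A i) X" and \<phi>2: "\<phi> 2 \<in> Mor \<C> Q X"
      using \<phi>[of 1] \<phi>[of 2] by auto
    have "(if j = i then \<phi> 1 else \<phi> 2 \<cdot> \<mu> j) \<in> Mor \<C> (A j) X" if "j \<in> I" for j
      using \<phi>1 comp_Mor[OF coproduct_inj[OF q] \<phi>2] that by simp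
    then obtain h where h: "h \<in> Mor \<C> P X"
      and h\<nu>: "\<And>j. j \<in> I \<Longrightarrow> h \<cdot> \<nu> j = (if j = i then \<phi> 1 else \<phi> 2 \<cdot> \<mu> j)"
      using coproduct_mediator[OF c X, of "\<lambda>j. if j = i then \<phi> 1 else \<phi> 2 \<cdot> \<mu> j"] by blast
    have "h \<cdot> \<kappa> = \<phi> 2"
      by (rule coproduct_eqI[OF q comp_Mor[OF \<kappa> h] \<phi>2]) (use assoc[OF h] h\<nu> in auto)
    then show "\<exists>h\<in>Mor \<C> P X. \<forall>k\<in>{1, 2}. h \<cdot> (if k = 1 then \<nu> i else \<kappa>) = \<phi> k"
      using h h\<nu>[OF i] by auto
  next
    fix X h h'
    assume h: "h \<in> Mor \<C> P X" "h' \<in> Mor \<C> P X"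
      and eq: "\<And>k. k \<in> {1, 2 :: nat} \<Longrightarrow>
            h \<cdot> (if k = 1 then \<nu> i else \<kappa>) = h' \<cdot> (if k = 1 then \<nu> i else \<kappa>)"
    have "h \<cdot> \<nu> i = h' \<cdot> \<nu> i" "h \<cdot> \<kappa> = h' \<cdot> \<kappa>" using eq[of 1] eq[of 2] by auto
    then show "h = h'"
      using assoc[OF h(1)] assoc[OF h(2)] by (intro coproduct_eqI[OF c h]) (metis Diff_iff singletonD)
  qed (rule P)
  then show ?thesis by blast
qed

text \<open>The converse direction, attaching a summand. The index set \<open>J\<close> may exhaust its
  type, so the enlarged family is indexed by options.\<close>

lemma coproduct_extend:
  assumes c: "is_coproduct \<C> {1, 2 :: nat} A P \<nu>"
    and q: "is_coproduct \<C> J B (A 2) \<mu>"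
  shows "is_coproduct \<C> (insert None (Some ` J)) (case_option (A 1) B) P
           (case_option (\<nu> 1) (\<lambda>j. \<nu> 2 \<cdot> \<mu> j))"
proof -
  have \<nu>1: "\<nu> 1 \<in> Mor \<C> (A 1) P" and \<nu>2: "\<nu> 2 \<in> Mor \<C> (A 2) P"
    using coproduct_inj[OF c] by auto
  have assoc: "(h \<cdot> \<nu> 2) \<cdot> \<mu> j = h \<cdot> (\<nu> 2 \<cdot> \<mu> j)" if "h \<in> Mor \<C> P X" "j \<in> J" for h X j
    using comp_assoc[OF coproduct_inj[OF q that(2)] \<nu>2 that(1)] .
  show ?thesis
  proof (rule is_coproductI)
    show "P \<in> Obj \<C>" using c by (rule coproduct_obj)
    show "case_option (\<nu> 1) (\<lambda>j. \<nu> 2 \<cdot> \<mu> j) i \<in> Mor \<C> (case_option (A 1) B i) P"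
      if "i \<in> insert None (Some ` J)" for i
      using that \<nu>1 comp_Mor[OF coproduct_inj[OF q] \<nu>2] by auto
  next
    fix X \<phi>
    assume X: "X \<in> Obj \<C>"
      and \<phi>: "\<And>i. i \<in> insert None (Some ` J) \<Longrightarrow> \<phi> i \<in> Mor \<C> (case_option (A 1) B i) X"
    have \<phi>1: "\<phi> None \<in> Mor \<C> (A 1) X" using \<phi>[of None] by simp
    have "\<phi> (Some j) \<in> Mor \<C> (B j) X" if "j \<in> J" for j using \<phi>[of "Some j"] that by simp
    then obtain k where k: "k \<in> Mor \<C> (A 2) X" and k\<mu>: "\<And>j. j \<in> J \<Longrightarrow> k \<cdot> \<mu> j = \<phi> (Some j)"
      using coproduct_mediator[OF q X, of "\<lambda>j. \<phi> (Some j)"] by blast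
    have "(if n = 1 then \<phi> None else k) \<in> Mor \<C> (A n) X" if "n \<in> {1, 2}" for n :: nat
      using that \<phi>1 k by auto
    then obtain h where h: "h \<in> Mor \<C> P X"
      and h\<nu>: "\<And>n. n \<in> {1, 2} \<Longrightarrow> h \<cdot> \<nu> n = (if n = 1 then \<phi> None else k)"
      using coproduct_mediator[OF c X, of "\<lambda>n. if n = 1 then \<phi> None else k"] by blast
    have "h \<cdot> \<nu> 1 = \<phi> None" "h \<cdot> \<nu> 2 = k" using h\<nu>[of 1] h\<nu>[of 2] by auto
    then show "\<exists>h\<in>Mor \<C> P X. \<forall>i\<in>insert None (Some ` J).
        h \<cdot> case_option (\<nu> 1) (\<lambda>j. \<nu> 2 \<cdot> \<mu> j) i = \<phi> i"
      using h k\<mu> assoc[OF h] by (intro bexI[of _ h]) auto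
  next
    fix X h h'
    assume h: "h \<in> Mor \<C> P X" "h' \<in> Mor \<C> P X"
      and eq: "\<And>i. i \<in> insert None (Some ` J) \<Longrightarrow>
        h \<cdot> case_option (\<nu> 1) (\<lambda>j. \<nu> 2 \<cdot> \<mu> j) i = h' \<cdot> case_option (\<nu> 1) (\<lambda>j. \<nu> 2 \<cdot> \<mu> j) i"
    have e1: "h \<cdot> \<nu> 1 = h' \<cdot> \<nu> 1" using eq[of None] by simp
    have "h \<cdot> (\<nu> 2 \<cdot> \<mu> j) = h' \<cdot> (\<nu> 2 \<cdot> \<mu> j)" if "j \<in> J" for j using eq[of "Some j"] that by simp
    then have e2: "h \<cdot> \<nu> 2 = h' \<cdot> \<nu> 2"
      using assoc[OF h(1)] assoc[OF h(2)]
      by (intro coproduct_eqI[OF q comp_Mor[OF \<nu>2 h(1)] comp_Mor[OF \<nu>2 h(2)]]) simp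
    show "h = h'" by (rule coproduct_eqI[OF c h]) (use e1 e2 in auto)
  qed
qed

text \<open>Composing \<open>\<nu>\<close> with the unique morphism back from the initial object gives an endomorphism
  of \<open>T\<close>, hence the identity; so \<open>\<nu>\<close> is both split epi and mono.\<close>

lemma mono_to_initial_isomorphic:
  assumes T: "initial \<C> T" and \<nu>: "\<nu> \<in> Mor \<C> B T" "mono_arr \<C> \<nu>"
  shows "isomorphic \<C> B T"
proof -
  have obj: "B \<in> Obj \<C>" "T \<in> Obj \<C>" using Mor_ObjD[OF \<nu>(1)] by auto
  have "\<exists>!t. t \<in> Mor \<C> T B" and end_unique: "\<exists>!e. e \<in> Mor \<C> T T"
    using T obj unfolding initial_def by auto
  then obtain t where t: "t \<in> Mor \<C> T B" by blast
  have \<nu>t: "\<nu> \<cdot> t = Id \<C> T"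
    using end_unique comp_Mor[OF t \<nu>(1)] Id_Mor[OF obj(2)] by auto
  have "\<nu> \<cdot> (t \<cdot> \<nu>) = \<nu> \<cdot> Id \<C> B"
    using comp_assoc[OF \<nu>(1) t \<nu>(1)] \<nu>t Id_comp[OF \<nu>(1)] comp_Id[OF \<nu>(1)] by simp
  then have "t \<cdot> \<nu> = Id \<C> B"
    by (rule mono_arrD[OF \<nu>(2) \<nu>(1) comp_Mor[OF \<nu>(1) t] Id_Mor[OF obj(1)]])
  then have "iso_arr \<C> \<nu>" using \<nu>t t Mor_DomCod[OF \<nu>(1)] unfolding iso_arr_def by auto
  then show ?thesis unfolding isomorphic_def using \<nu>(1) by blast
qed

end

section \<open>Underlying sets in a UD-category\<close>

text \<open>The variable \<open>ty\<close> fixes the type of the indices of families, on which the notion of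
  UD-category depends.\<close>

locale UD_cat = categ \<C> for \<C> :: "('o, 'm) cat" (structure) +
  fixes U :: "('o, 'm, 'u) set_functr" and ty :: "'i itself"
  assumes infinite_index: "infinite (UNIV :: 'i set)"
    and UD: "UD_category ty \<C> U"
begin

lemma on_arr_Mor:
  assumes "f \<in> Mor \<C> A B"
  shows "src (on_arr U f) = on_obj U A" "fn (on_arr U f) \<in> on_obj U A \<rightarrow> on_obj U B"
proof -
  have "on_arr U f \<in> Mor SetCat (on_obj U A) (on_obj U B)"
    using UD assms unfolding UD_category_def concrete_category_def is_functor_def by blast
  then show "src (on_arr U f) = on_obj U A" "fn (on_arr U f) \<in> on_obj U A \<rightarrow> on_obj U B"
    unfolding Mor_def SetCat_def by auto
qed

lemma U_image_eq: "f \<in> Mor \<C> A B \<Longrightarrow> U_image \<C> U f = fn (on_arr U f) ` on_obj U A"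
  unfolding U_image_def using Mor_DomCod by auto

lemma U_image_subset: "f \<in> Mor \<C> A B \<Longrightarrow> U_image \<C> U f \<subseteq> on_obj U B"
  using on_arr_Mor(2) U_image_eq by fastforce

lemma U_image_Id:
  assumes "A \<in> Obj \<C>" shows "U_image \<C> U (Id \<C> A) = on_obj U A"
proof -
  have "on_arr U (Id \<C> A) = Id SetCat (on_obj U A)"
    using UD assms unfolding UD_category_def concrete_category_def is_functor_def by blast
  then show ?thesis using U_image_eq[OF Id_Mor[OF assms]] unfolding SetCat_def by auto
qed

lemma U_image_comp:
  assumes "f \<in> Mor \<C> A B" "g \<in> Mor \<C> B D"
  shows "U_image \<C> U (g \<cdot> f) \<subseteq> U_image \<C> U g"
proof -
  have "on_arr U (g \<cdot> f) = on_arr U g \<cdot>\<^bsub>SetCat\<^esub> on_arr U f"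
    using UD assms unfolding UD_category_def concrete_category_def is_functor_def by blast
  then have "fn (on_arr U (g \<cdot> f)) x = fn (on_arr U g) (fn (on_arr U f) x)" if "x \<in> on_obj U A" for x
    using that on_arr_Mor(1)[OF assms(1)] unfolding SetCat_def by (simp add: compose_def)
  then show ?thesis
    using on_arr_Mor(2)[OF assms(1)] U_image_eq[OF comp_Mor[OF assms]] U_image_eq[OF assms(2)]
    by auto
qed

lemma U_image_set_subobject: "set_subobject \<C> U A X S \<iota> \<Longrightarrow> U_image \<C> U \<iota> = X"
  unfolding set_subobject_def subobject_def using U_image_eq[of \<iota> S A] by (auto simp: incl_def)

text \<open>One direction is \<open>UD3\<close>; for the other, a composite has a smaller image than its last
  factor.\<close>

lemma factors_iff_image:
  assumes f: "f \<in> Mor \<C> X B" and \<nu>: "\<nu> \<in> Mor \<C> S B" "mono_arr \<C> \<nu>"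
  shows "factors_through \<C> f \<nu> \<longleftrightarrow> U_image \<C> U f \<subseteq> U_image \<C> U \<nu>"
proof
  assume "factors_through \<C> f \<nu>"
  then show "U_image \<C> U f \<subseteq> U_image \<C> U \<nu>"
    unfolding factors_through_def using Mor_DomCod[OF f] Mor_DomCod[OF \<nu>(1)] U_image_comp[OF _ \<nu>(1)]
    by auto
next
  assume sub: "U_image \<C> U f \<subseteq> U_image \<C> U \<nu>"
  have "subobject \<C> B S \<nu>" unfolding subobject_def using \<nu> Mor_ObjD by blast
  then have "\<exists>g\<in>Mor \<C> X S. f = \<nu> \<cdot> g"
    using UD f sub unfolding UD_category_def UD3_def by blast
  then show "factors_through \<C> f \<nu>"
    unfolding factors_through_def using Mor_DomCod[OF f] Mor_DomCod[OF \<nu>(1)] by simp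
qed

lemma subobject_Inter_Union:
  fixes I :: "'i set"
  assumes "A \<in> Obj \<C>" "I \<noteq> {}" "\<forall>i\<in>I. subobject \<C> A (B i) (\<nu> i)"
  shows "\<exists>S \<iota>. set_subobject \<C> U A (\<Inter>i\<in>I. U_image \<C> U (\<nu> i)) S \<iota>"
    and "\<exists>S \<iota>. set_subobject \<C> U A (\<Union>i\<in>I. U_image \<C> U (\<nu> i)) S \<iota>"
proof -
  have "UD4 ty \<C> U" using UD unfolding UD_category_def by blast
  then have "I \<noteq> {} \<longrightarrow> (\<forall>i\<in>I. subobject \<C> A (B i) (\<nu> i)) \<longrightarrow>
      (\<exists>S \<iota>. set_subobject \<C> U A (\<Inter>i\<in>I. U_image \<C> U (\<nu> i)) S \<iota>) \<and>
      (\<exists>S \<iota>. set_subobject \<C> U A (\<Union>i\<in>I. U_image \<C> U (\<nu> i)) S \<iota>)"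
    using assms(1) unfolding UD4_def by (elim ballE allE) auto
  then show "\<exists>S \<iota>. set_subobject \<C> U A (\<Inter>i\<in>I. U_image \<C> U (\<nu> i)) S \<iota>"
    and "\<exists>S \<iota>. set_subobject \<C> U A (\<Union>i\<in>I. U_image \<C> U (\<nu> i)) S \<iota>"
    using assms(2,3) by simp_all
qed

text \<open>A point of an initial object would, by \<open>UD6\<close>, lie in an indecomposable subobject, which
  is then itself isomorphic to the initial object.\<close>

lemma initial_empty:
  assumes "initial \<C> T" shows "on_obj U T = {}"
proof (rule ccontr)
  assume "on_obj U T \<noteq> {}"
  then obtain x where "x \<in> on_obj U T" by blast
  then obtain B \<nu> where "subobject \<C> T B \<nu>" and ind: "indecomposable \<C> B"
    using UD assms unfolding UD_category_def UD6_def initial_def by blast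
  then have "isomorphic \<C> B T"
    unfolding subobject_def using mono_to_initial_isomorphic[OF assms] by blast
  then show False using ind assms unfolding indecomposable_def by blast
qed

lemma isomorphic_initial_empty:
  assumes "initial \<C> T" "isomorphic \<C> S T" shows "on_obj U S = {}"
proof -
  obtain f where "f \<in> Mor \<C> S T" using assms(2) unfolding isomorphic_def by blast
  then show ?thesis using on_arr_Mor(2)[of f S T] initial_empty[OF assms(1)] by auto
qed

text \<open>The axiom \<open>UD5\<close> speaks of the indices 0 and 1.\<close>

lemma binary_coproduct_shift:
  assumes "is_coproduct \<C> {1, 2 :: nat} A P \<nu>"
  shows "is_coproduct \<C> {0, 1 :: nat} (A \<circ> Suc) P (\<nu> \<circ> Suc)"
  by (rule coproduct_reindex[OF assms]) (auto simp: bij_betw_def)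

lemma binary_injections_mono:
  assumes "is_coproduct \<C> {1, 2 :: nat} A P \<nu>" "i \<in> {1, 2}"
  shows "mono_arr \<C> (\<nu> i)"
proof -
  have "mono_arr \<C> ((\<nu> \<circ> Suc) 0) \<and> mono_arr \<C> ((\<nu> \<circ> Suc) 1)"
    using UD binary_coproduct_shift[OF assms(1)] unfolding UD_category_def UD5_def by blast
  then show ?thesis using assms(2) by (auto simp: numeral_2_eq_2)
qed

lemma binary_images_disjoint:
  assumes c: "is_coproduct \<C> {1, 2 :: nat} A P \<nu>"
  shows "U_image \<C> U (\<nu> 1) \<inter> U_image \<C> U (\<nu> 2) = {}"
proof -
  have P: "P \<in> Obj \<C>" using c by (rule coproduct_obj)
  have sub: "subobject \<C> P (A n) (\<nu> n)" if "n \<in> {1, 2}" for n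
    unfolding subobject_def
    using coproduct_inj[OF c that] binary_injections_mono[OF c that] Mor_ObjD by blast
  \<comment> \<open>\<open>UD4\<close> takes indices of type \<open>'i\<close>, so two of them have to be chosen.\<close>
  obtain a b :: 'i where ab: "a \<noteq> b"
    using ex_new_if_finite[OF infinite_index, of "{undefined}"] by auto
  let ?n = "\<lambda>i. if i = a then 1 else 2 :: nat"
  have "\<forall>i\<in>{a, b}. subobject \<C> P (A (?n i)) (\<nu> (?n i))" using sub by simp
  then have "\<exists>S \<iota>. set_subobject \<C> U P (\<Inter>i\<in>{a, b}. U_image \<C> U (\<nu> (?n i))) S \<iota>"
    by (rule subobject_Inter_Union(1)[OF P, rotated]) simp
  moreover have "(\<Inter>i\<in>{a, b}. U_image \<C> U (\<nu> (?n i))) = U_image \<C> U (\<nu> 1) \<inter> U_image \<C> U (\<nu> 2)"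
    using ab by auto
  ultimately obtain S \<iota> where S: "set_subobject \<C> U P (U_image \<C> U (\<nu> 1) \<inter> U_image \<C> U (\<nu> 2)) S \<iota>"
    by auto
  have "set_subobject \<C> U P (U_image \<C> U ((\<nu> \<circ> Suc) 0) \<inter> U_image \<C> U ((\<nu> \<circ> Suc) 1)) S \<iota>"
    using S by (simp add: numeral_2_eq_2)
  then obtain T where "initial \<C> T" "isomorphic \<C> S T"
    using UD binary_coproduct_shift[OF c] unfolding UD_category_def UD5_def by blast
  then show ?thesis using isomorphic_initial_empty S unfolding set_subobject_def by auto
qed

text \<open>Every summand has a complement, because the coproduct of the others exists.\<close>

lemma coproduct_complement:
  fixes I :: "'i set"
  assumes "is_coproduct \<C> I A P \<nu>" "i \<in> I"
  obtains Q \<mu> \<kappa> where "is_coproduct \<C> (I - {i}) A Q \<mu>"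
    and "is_coproduct \<C> {1, 2 :: nat} (\<lambda>k. if k = 1 then A i else Q) P
           (\<lambda>k. if k = 1 then \<nu> i else \<kappa>)"
proof -
  have "\<forall>j\<in>I - {i}. A j \<in> Obj \<C>" using assms(1) unfolding is_coproduct_def by blast
  then obtain Q \<mu> where "is_coproduct \<C> (I - {i}) A Q \<mu>"
    using UD unfolding UD_category_def UD1_def coproduct_complete_def by blast
  then show thesis using that coproduct_split[OF assms] by blast
qed

lemma injections_mono:
  fixes I :: "'i set"
  assumes "is_coproduct \<C> I A P \<nu>" "i \<in> I"
  shows "mono_arr \<C> (\<nu> i)"
proof -
  obtain Q \<mu> \<kappa> where "is_coproduct \<C> {1, 2 :: nat} (\<lambda>k. if k = 1 then A i else Q) P
      (\<lambda>k. if k = 1 then \<nu> i else \<kappa>)"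
    using coproduct_complement[OF assms] by blast
  then show ?thesis using binary_injections_mono[of _ P _ 1] by fastforce
qed

text \<open>All injections factorize through the union \<open>\<iota> : S \<rightarrow> P\<close> of their images, so the universal
  property gives a section of \<open>\<iota>\<close>; hence the inclusion \<open>U(\<iota>)\<close> is onto.\<close>

lemma coproduct_images_cover:
  fixes I :: "'i set"
  assumes c: "is_coproduct \<C> I A P \<nu>" and ne: "I \<noteq> {}"
  shows "on_obj U P = (\<Union>i\<in>I. U_image \<C> U (\<nu> i))"
proof
  have P: "P \<in> Obj \<C>" using c by (rule coproduct_obj)
  have "\<forall>i\<in>I. subobject \<C> P (A i) (\<nu> i)"
    unfolding subobject_def using coproduct_inj[OF c] injections_mono[OF c] Mor_ObjD by blast
  then obtain S \<iota> where S: "set_subobject \<C> U P (\<Union>i\<in>I. U_image \<C> U (\<nu> i)) S \<iota>"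
    using subobject_Inter_Union(2)[OF P ne] by blast
  then have \<iota>: "\<iota> \<in> Mor \<C> S P" "mono_arr \<C> \<iota>" and S_obj: "S \<in> Obj \<C>"
    unfolding set_subobject_def subobject_def by auto
  have "\<exists>g\<in>Mor \<C> (A i) S. \<nu> i = \<iota> \<cdot> g" if i: "i \<in> I" for i
  proof -
    have "U_image \<C> U (\<nu> i) \<subseteq> U_image \<C> U \<iota>" using U_image_set_subobject[OF S] i by auto
    then have "factors_through \<C> (\<nu> i) \<iota>" using factors_iff_image[OF coproduct_inj[OF c i] \<iota>] by simp
    then show ?thesis
      unfolding factors_through_def
      using Mor_DomCod[OF coproduct_inj[OF c i]] Mor_DomCod[OF \<iota>(1)] by simp
  qed
  then obtain g where g: "\<And>i. i \<in> I \<Longrightarrow> g i \<in> Mor \<C> (A i) S" "\<And>i. i \<in> I \<Longrightarrow> \<nu> i = \<iota> \<cdot> g i"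
    by metis
  obtain h where h: "h \<in> Mor \<C> P S" and hg: "\<And>i. i \<in> I \<Longrightarrow> h \<cdot> \<nu> i = g i"
    using coproduct_mediator[OF c S_obj g(1)] by blast
  have "\<iota> \<cdot> h = Id \<C> P"
  proof (rule coproduct_eqI[OF c comp_Mor[OF h \<iota>(1)] Id_Mor[OF P]])
    fix i assume i: "i \<in> I"
    have "(\<iota> \<cdot> h) \<cdot> \<nu> i = \<nu> i"
      using comp_assoc[OF coproduct_inj[OF c i] h \<iota>(1)] hg[OF i] g(2)[OF i] by simp
    then show "(\<iota> \<cdot> h) \<cdot> \<nu> i = Id \<C> P \<cdot> \<nu> i" using Id_comp[OF coproduct_inj[OF c i]] by simp
  qed
  then have "on_obj U P \<subseteq> U_image \<C> U \<iota>" using U_image_comp[OF h \<iota>(1)] U_image_Id[OF P] by simp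
  then show "on_obj U P \<subseteq> (\<Union>i\<in>I. U_image \<C> U (\<nu> i))" using U_image_set_subobject[OF S] by simp
  show "(\<Union>i\<in>I. U_image \<C> U (\<nu> i)) \<subseteq> on_obj U P"
    using U_image_subset[OF coproduct_inj[OF c]] by blast
qed

section \<open>Factorization through a single summand\<close>

lemma family_factors_iff_image:
  fixes I :: "'i set"
  assumes "is_coproduct \<C> I A P \<nu>" "f \<in> Mor \<C> C P"
  shows "(\<exists>i\<in>I. factors_through \<C> f (\<nu> i)) \<longleftrightarrow> (\<exists>i\<in>I. U_image \<C> U f \<subseteq> U_image \<C> U (\<nu> i))"
  using factors_iff_image[OF assms(2) coproduct_inj[OF assms(1)] injections_mono[OF assms(1)]]
  by blast

lemma binary_factors_iff_image:
  assumes "is_coproduct \<C> {1, 2 :: nat} A P \<nu>" "f \<in> Mor \<C> C P"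
  shows "(\<exists>i\<in>{1, 2}. factors_through \<C> f (\<nu> i)) \<longleftrightarrow>
         (\<exists>i\<in>{1, 2}. U_image \<C> U f \<subseteq> U_image \<C> U (\<nu> i))"
  using factors_iff_image[OF assms(2) coproduct_inj[OF assms(1)] binary_injections_mono[OF assms(1)]]
  by blast

lemma connected_iff_factors:
  "connected_object ty \<C> \<D> C \<longleftrightarrow>
     (\<forall>(I :: 'i set) A P \<nu>. I \<noteq> {} \<longrightarrow> (\<forall>i\<in>I. A i \<in> \<D>) \<longrightarrow> is_coproduct \<C> I A P \<nu> \<longrightarrow>
        (\<forall>f\<in>Mor \<C> C P. \<exists>i\<in>I. factors_through \<C> f (\<nu> i)))"
proof -
  have "Psi \<C> \<nu> ` (SIGMA i:I. Mor \<C> C (A i)) = Mor \<C> C P \<longleftrightarrow>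
        (\<forall>f\<in>Mor \<C> C P. \<exists>i\<in>I. factors_through \<C> f (\<nu> i))"
    if c: "is_coproduct \<C> I A P \<nu>" for I :: "'i set" and A P \<nu>
  proof -
    have "Psi \<C> \<nu> ` (SIGMA i:I. Mor \<C> C (A i)) \<subseteq> Mor \<C> C P"
      unfolding Psi_def using comp_Mor[OF _ coproduct_inj[OF c]] by auto
    moreover have "f \<in> Psi \<C> \<nu> ` (SIGMA i:I. Mor \<C> C (A i)) \<longleftrightarrow> (\<exists>i\<in>I. factors_through \<C> f (\<nu> i))"
      if "f \<in> Mor \<C> C P" for f
      using Mor_DomCod[OF that] Mor_DomCod[OF coproduct_inj[OF c]]
      unfolding Psi_def factors_through_def by (auto simp: image_iff)
    ultimately show ?thesis by blast
  qed
  then show ?thesis unfolding connected_object_def by (simp cong: imp_cong)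
qed

text \<open>The implication from (4) to (2), for fixed \<open>C\<close> and \<open>\<D>\<close>.\<close>

lemma binary_factorization:
  assumes fam: "\<And>(I :: 'i set) A P \<nu> f. I \<noteq> {} \<Longrightarrow> (\<forall>i\<in>I. A i \<in> \<D>) \<Longrightarrow> is_coproduct \<C> I A P \<nu> \<Longrightarrow>
        f \<in> Mor \<C> C P \<Longrightarrow> \<exists>i\<in>I. factors_through \<C> f (\<nu> i)"
    and A: "A 1 \<in> \<D>" "A 2 \<in> coproducts_of ty \<C> \<D>"
    and c: "is_coproduct \<C> {1, 2 :: nat} A P \<nu>" and f: "f \<in> Mor \<C> C P"
  shows "\<exists>i\<in>{1, 2}. factors_through \<C> f (\<nu> i)"
proof -
  obtain J :: "'i set" and B \<mu> where B: "\<forall>j\<in>J. B j \<in> \<D>" and q: "is_coproduct \<C> J B (A 2) \<mu>"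
    using A(2) unfolding coproducts_of_def by blast
  have \<nu>2: "\<nu> 2 \<in> Mor \<C> (A 2) P" using coproduct_inj[OF c] by auto
  \<comment> \<open>Hilbert's hotel: shift the old indices off some \<open>a\<close>, which then serves the new summand.\<close>
  obtain s :: "'i \<Rightarrow> 'i" and a where s: "bij_betw s UNIV (UNIV - {a})"
    using infinite_imp_bij_betw[OF infinite_index] by blast
  let ?K = "insert None (Some ` J)" and ?\<tau> = "case_option a s"
  have "s j \<noteq> a" for j using s bij_betwE by fastforce
  moreover have "inj s" using s by (rule bij_betw_imp_inj_on)
  ultimately have "inj_on ?\<tau> ?K" by (auto simp: inj_on_def)
  then have "bij_betw (inv_into ?K ?\<tau>) (?\<tau> ` ?K) ?K"
    by (intro bij_betw_inv_into inj_on_imp_bij_betw)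
  note c' = coproduct_reindex[OF coproduct_extend[OF c q] this]
  have "\<forall>i\<in>?\<tau> ` ?K. (case_option (A 1) B \<circ> inv_into ?K ?\<tau>) i \<in> \<D>"
  proof
    fix i assume "i \<in> ?\<tau> ` ?K"
    then have "inv_into ?K ?\<tau> i \<in> ?K" by (rule inv_into_into)
    then show "(case_option (A 1) B \<circ> inv_into ?K ?\<tau>) i \<in> \<D>" using A(1) B by auto
  qed
  then obtain i where "i \<in> ?\<tau> ` ?K"
    and i: "factors_through \<C> f ((case_option (\<nu> 1) (\<lambda>j. \<nu> 2 \<cdot> \<mu> j) \<circ> inv_into ?K ?\<tau>) i)"
    using fam[OF _ _ c' f] by blast
  then have "inv_into ?K ?\<tau> i \<in> ?K" by (intro inv_into_into)
  then consider "factors_through \<C> f (\<nu> 1)"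
    | j where "j \<in> J" "factors_through \<C> f (\<nu> 2 \<cdot> \<mu> j)"
    using i by auto
  then show ?thesis
  proof cases
    case 2
    have \<mu>: "\<mu> j \<in> Mor \<C> (B j) (A 2)" using coproduct_inj[OF q 2(1)] .
    obtain g where g: "g \<in> Mor \<C> C (B j)" "f = (\<nu> 2 \<cdot> \<mu> j) \<cdot> g"
      using 2(2) Mor_DomCod[OF f] Mor_DomCod[OF comp_Mor[OF \<mu> \<nu>2]] unfolding factors_through_def by auto
    then have "f = \<nu> 2 \<cdot> (\<mu> j \<cdot> g)" using comp_assoc[OF g(1) \<mu> \<nu>2] by simp
    then have "factors_through \<C> f (\<nu> 2)"
      using comp_Mor[OF g(1) \<mu>] Mor_DomCod[OF f] Mor_DomCod[OF \<nu>2] unfolding factors_through_def by auto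
    then show ?thesis by blast
  qed blast
qed

text \<open>The implication from (3) to (5): a single point of the image of \<open>f\<close> determines which summand
  to detach from the family.\<close>

lemma family_image:
  fixes I :: "'i set"
  assumes bin: "\<And>A P \<nu> f. A 1 \<in> \<D> \<Longrightarrow> A 2 \<in> coproducts_of ty \<C> \<D> \<Longrightarrow>
        is_coproduct \<C> {1, 2 :: nat} A P \<nu> \<Longrightarrow> f \<in> Mor \<C> C P \<Longrightarrow>
        \<exists>i\<in>{1, 2}. U_image \<C> U f \<subseteq> U_image \<C> U (\<nu> i)"
    and ne: "I \<noteq> {}" and A: "\<forall>i\<in>I. A i \<in> \<D>" and c: "is_coproduct \<C> I A P \<nu>"
    and f: "f \<in> Mor \<C> C P"
  shows "\<exists>i\<in>I. U_image \<C> U f \<subseteq> U_image \<C> U (\<nu> i)"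
proof (cases "U_image \<C> U f = {}")
  case False
  then obtain y where y: "y \<in> U_image \<C> U f" by blast
  then obtain i where i: "i \<in> I" and yi: "y \<in> U_image \<C> U (\<nu> i)"
    using U_image_subset[OF f] coproduct_images_cover[OF c ne] by blast
  obtain Q \<mu> \<kappa> where q: "is_coproduct \<C> (I - {i}) A Q \<mu>"
    and b: "is_coproduct \<C> {1, 2 :: nat} (\<lambda>k. if k = 1 then A i else Q) P
              (\<lambda>k. if k = 1 then \<nu> i else \<kappa>)"
    using coproduct_complement[OF c i] by blast
  have "Q \<in> coproducts_of ty \<C> \<D>" unfolding coproducts_of_def using q A by blast
  then have "U_image \<C> U f \<subseteq> U_image \<C> U (\<nu> i) \<or> U_image \<C> U f \<subseteq> U_image \<C> U \<kappa>"
    using bin[OF _ _ b f] A i by auto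
  moreover have "y \<notin> U_image \<C> U \<kappa>" using binary_images_disjoint[OF b] yi by auto
  ultimately show ?thesis using y i by blast
qed (use ne in blast)

end

theorem theorem5p3:
  fixes \<C> :: "('o, 'm) cat"
    and U :: "('o, 'm, 'u) set_functr"
    and C :: 'o
    and \<D> :: "'o set"
  assumes "infinite (UNIV :: 'i set)"
    and "UD_category TYPE('i) \<C> U"
    and "C \<in> Obj \<C>"
    and "\<D> \<subseteq> Obj \<C>"
  shows
    "let c1 = connected_object TYPE('i) \<C> \<D> C;
         c2 = (\<forall>A P \<nu>. A 1 \<in> \<D> \<longrightarrow> A 2 \<in> coproducts_of TYPE('i) \<C> \<D> \<longrightarrow>
                 is_coproduct \<C> {1, 2 :: nat} A P \<nu> \<longrightarrow>
                 (\<forall>f\<in>Mor \<C> C P. \<exists>i\<in>{1, 2}. factors_through \<C> f (\<nu> i)));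
         c3 = (\<forall>A P \<nu>. A 1 \<in> \<D> \<longrightarrow> A 2 \<in> coproducts_of TYPE('i) \<C> \<D> \<longrightarrow>
                 is_coproduct \<C> {1, 2 :: nat} A P \<nu> \<longrightarrow>
                 (\<forall>f\<in>Mor \<C> C P. \<exists>i\<in>{1, 2}. U_image \<C> U f \<subseteq> U_image \<C> U (\<nu> i)));
         c4 = (\<forall>(I :: 'i set) A P \<nu>. I \<noteq> {} \<longrightarrow> (\<forall>i\<in>I. A i \<in> \<D>) \<longrightarrow>
                 is_coproduct \<C> I A P \<nu> \<longrightarrow>
                 (\<forall>f\<in>Mor \<C> C P. \<exists>i\<in>I. factors_through \<C> f (\<nu> i)));
         c5 = (\<forall>(I :: 'i set) A P \<nu>. I \<noteq> {} \<longrightarrow> (\<forall>i\<in>I. A i \<in> \<D>) \<longrightarrow>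
                 is_coproduct \<C> I A P \<nu> \<longrightarrow>
                 (\<forall>f\<in>Mor \<C> C P. \<exists>i\<in>I. U_image \<C> U f \<subseteq> U_image \<C> U (\<nu> i)))
     in (c1 \<longleftrightarrow> c2) \<and> (c2 \<longleftrightarrow> c3) \<and> (c3 \<longleftrightarrow> c4) \<and> (c4 \<longleftrightarrow> c5)"
proof -
  interpret categ \<C>
    using assms(2) by unfold_locales (simp add: UD_category_def concrete_category_def)
  interpret UD_cat \<C> U "TYPE('i)"
    using assms(1,2) by unfold_locales
  let ?c2 = "\<forall>A P \<nu>. A 1 \<in> \<D> \<longrightarrow> A 2 \<in> coproducts_of TYPE('i) \<C> \<D> \<longrightarrow>
                 is_coproduct \<C> {1, 2 :: nat} A P \<nu> \<longrightarrow>
                 (\<forall>f\<in>Mor \<C> C P. \<exists>i\<in>{1, 2}. factors_through \<C> f (\<nu> i))"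
  let ?c3 = "\<forall>A P \<nu>. A 1 \<in> \<D> \<longrightarrow> A 2 \<in> coproducts_of TYPE('i) \<C> \<D> \<longrightarrow>
                 is_coproduct \<C> {1, 2 :: nat} A P \<nu> \<longrightarrow>
                 (\<forall>f\<in>Mor \<C> C P. \<exists>i\<in>{1, 2}. U_image \<C> U f \<subseteq> U_image \<C> U (\<nu> i))"
  let ?c4 = "\<forall>(I :: 'i set) A P \<nu>. I \<noteq> {} \<longrightarrow> (\<forall>i\<in>I. A i \<in> \<D>) \<longrightarrow>
                 is_coproduct \<C> I A P \<nu> \<longrightarrow>
                 (\<forall>f\<in>Mor \<C> C P. \<exists>i\<in>I. factors_through \<C> f (\<nu> i))"
  let ?c5 = "\<forall>(I :: 'i set) A P \<nu>. I \<noteq> {} \<longrightarrow> (\<forall>i\<in>I. A i \<in> \<D>) \<longrightarrow>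
                 is_coproduct \<C> I A P \<nu> \<longrightarrow>
                 (\<forall>f\<in>Mor \<C> C P. \<exists>i\<in>I. U_image \<C> U f \<subseteq> U_image \<C> U (\<nu> i))"
  have c23: "?c2 \<longleftrightarrow> ?c3"
    by (simp only: binary_factors_iff_image cong: imp_cong ball_cong)
  have c45: "?c4 \<longleftrightarrow> ?c5"
    by (simp only: family_factors_iff_image cong: imp_cong ball_cong)
  have c42: ?c2 if ?c4
    using that by (intro allI impI ballI) (rule binary_factorization; blast)
  have c35: ?c5 if ?c3
    using that by (intro allI impI ballI) (rule family_image; blast)
  have "connected_object TYPE('i) \<C> \<D> C \<longleftrightarrow> ?c4" by (rule connected_iff_factors)
  with c23 c45 c42 c35 show ?thesis unfolding Let_def by argo
qed

end
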